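(* Let $C$ be a nonempty closed convex subset of a uniformly convex Banach space $X$ with the Opial property, and let $T:C\to C$ be a mapping satisfying condition $(C)$ such that $F(T)\neq\emptyset$. For arbitrarily chosen $x_0\in C$, let the sequence $\{x_n\}$ be generated by $$z_n=(1-\beta_n)x_n+\beta_nTx_n,\qquad y_n=T\big((1-\alpha_n)Tx_n+\alpha_nTz_n\big),\qquad x_{n+1}=Ty_n\qquad(n\ge 0),$$ where $\{\alpha_n\}$ and $\{\beta_n\}$ are sequences of real numbers in $[a,b]$ for some $a,b$ with $0<a\le b<1$. Then $\{x_n\}$ converges weakly to a fixed point of $T$.
   Context: $F(T)$ denotes the set of fixed points of $T$. A mapping $T:C\to C$ satisfies condition $(C)$ (is Suzuki generalized nonexpansive) if for all $x,y\in C$, $\frac12\|x-Tx\|\le\|x-y\|$ implies $\|Tx-Ty\|\le\|x-y\|$. A Banach space $X$ has the Opial property if for each sequence $\{x_n\}$ in $X$ converging weakly to $x\in X$, $\limsup_{n\to\infty}\|x_n-x\|<\limsup_{n\to\infty}\|x_n-y\|$ for all $y\in X$ with $y\ne x$. Uniform convexity of a Banach space is understood in the standard sense. *)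

theory Defs
  imports "HOL-Analysis.Analysis"
begin

(* The type class real_normed_vector has real scalars only.  A complex Banach space is covered by
   restricting scalars: none of the notions below changes, because the real parts of the bounded
   complex functionals are exactly the bounded real functionals. *)

definition fixed_points :: "'a set \<Rightarrow> ('a \<Rightarrow> 'a) \<Rightarrow> 'a set" where
  "fixed_points C T = {x \<in> C. T x = x}"

definition condition_C :: "'a::real_normed_vector set \<Rightarrow> ('a \<Rightarrow> 'a) \<Rightarrow> bool" where
  "condition_C C T \<longleftrightarrow>
     (\<forall>x\<in>C. \<forall>y\<in>C. 1 / 2 * norm (x - T x) \<le> norm (x - y) \<longrightarrow> norm (T x - T y) \<le> norm (x - y))"

definition weakly_convergent_to :: "(nat \<Rightarrow> 'a::real_normed_vector) \<Rightarrow> 'a \<Rightarrow> bool" where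
  "weakly_convergent_to u l \<longleftrightarrow>
     (\<forall>f :: 'a \<Rightarrow> real. bounded_linear f \<longrightarrow> (\<lambda>n. f (u n)) \<longlonglongrightarrow> f l)"

(* The property concerns the whole space; the itself argument names the type, as in CARD('a).
   The limsup is taken in ereal; it is finite in the cases at hand, since weakly convergent
   sequences are bounded. *)
definition opial_property :: "'a::real_normed_vector itself \<Rightarrow> bool" where
  "opial_property _ \<longleftrightarrow>
     (\<forall>(u :: nat \<Rightarrow> 'a) l. weakly_convergent_to u l \<longrightarrow>
        (\<forall>y. y \<noteq> l \<longrightarrow>
           limsup (\<lambda>n. ereal (norm (u n - l))) < limsup (\<lambda>n. ereal (norm (u n - y)))))"

definition uniformly_convex :: "'a::real_normed_vector itself \<Rightarrow> bool" where
  "uniformly_convex _ \<longleftrightarrow>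
     (\<forall>\<epsilon>::real. 0 < \<epsilon> \<and> \<epsilon> \<le> 2 \<longrightarrow>
        (\<exists>\<delta>>0. \<forall>x y :: 'a. norm x \<le> 1 \<longrightarrow> norm y \<le> 1 \<longrightarrow> norm (x - y) \<ge> \<epsilon> \<longrightarrow>
           norm ((1 / 2) *\<^sub>R (x + y)) \<le> 1 - \<delta>))"

end

theory Submission
  imports Defs
begin

text \<open>
  Every fixed point \<open>p\<close> satisfies \<open>norm (T w - p) \<le> norm (w - p)\<close> for \<open>w\<close> in \<open>C\<close>, so each of the
  convex combinations and applications of \<open>T\<close> that lead from \<open>x n\<close> to \<open>x (Suc n)\<close> brings the point
  no farther from \<open>p\<close>, and the distances \<open>norm (x n - p)\<close> decrease to a limit \<open>c\<close>. As \<open>z n\<close> enters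
  \<open>x (Suc n)\<close> with a weight of at least \<open>a\<close>, also \<open>norm (z n - p)\<close> tends to \<open>c\<close>. But \<open>z n - p\<close> is a
  convex combination of \<open>x n - p\<close> and \<open>T (x n) - p\<close>, which are both asymptotically in the ball of
  radius \<open>c\<close>, with weights bounded away from \<open>0\<close> and \<open>1\<close>; uniform convexity makes
  \<open>x n - T (x n)\<close> tend to \<open>0\<close> (lemma \<open>uniformly_convex_convex_combinations\<close>).

  It follows that \<open>x\<close> is a bounded sequence of approximate fixed points whose distance
  to each fixed point converges; such a sequence converges weakly to a fixed point (theorem
  \<open>weak_convergence_of_approximate_fixed_points\<close>). By weak sequential compactness every
  subsequence has a weakly convergent subsequence; its limit is a fixed point by Opial's property
  (\<open>condition_C_demiclosed\<close>); and two such limits \<open>p\<close>, \<open>q\<close>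
  agree, since otherwise Opial's property would give both \<open>lim norm (x n - p) < lim norm (x n
  - q)\<close> and the reverse inequality (\<open>opial_weak_limits_eq\<close>).

  Weak sequential compactness of bounded sequences in a uniformly convex Banach space also comes
  directly from the geometry of the norm. A weak limit along a subsequence of \<open>u\<close> is
  found as a point \<open>l\<close> that lies in the closed convex hull of \<open>u ` B\<close> for
  \<^emph>\<open>every\<close> infinite subset \<open>B\<close> of some index set \<open>A\<close>:
  a bounded functional \<open>f\<close> with \<open>f (u k) \<ge> f l + e\<close> for infinitely
  many \<open>k\<close> in \<open>A\<close> would separate \<open>l\<close> from one of these hulls.
  To get \<open>l\<close>, let \<open>D A\<close> be the limit of the distances from the origin to
  the closed convex hulls of the tails of \<open>u\<close> along \<open>A\<close>. Uniform convexity
  gives these nested hulls exactly one common point of norm \<open>D A\<close>. A diagonal argument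
  provides an \<open>A\<close> such that \<open>D B = D A\<close> for all infinite \<open>B
  \<subseteq> A\<close>; then the distinguished point of \<open>B\<close> is also one for
  \<open>A\<close>, hence all of them coincide.
\<close>

section \<open>Uniform convexity\<close>

text \<open>This form of uniform convexity, for a ball of arbitrary radius \<open>d\<close> and with points that may
  lie slightly outside of it, is the one that limit arguments need. For \<open>d = 0\<close> it is the triangle
  inequality; otherwise one scales by \<open>1 / (d + \<eta>)\<close>.\<close>

lemma uniformly_convex_midpoint:
  assumes "uniformly_convex TYPE('a::real_normed_vector)" and "0 \<le> d" and "0 < e"
  obtains \<eta> where "0 < \<eta>"
    and "\<And>x y :: 'a. norm x \<le> d + \<eta> \<Longrightarrow> norm y \<le> d + \<eta> \<Longrightarrow>
           d - \<eta> \<le> norm ((1 / 2) *\<^sub>R (x + y)) \<Longrightarrow> norm (x - y) < e"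
proof (cases "d = 0")
  case True
  show ?thesis
  proof (rule that[of "e / 3"])
    fix x y :: 'a
    assume "norm x \<le> d + e / 3" "norm y \<le> d + e / 3"
    then show "norm (x - y) < e"
      using True \<open>0 < e\<close> norm_triangle_ineq4[of x y] by linarith
  qed (use \<open>0 < e\<close> in simp)
next
  case False
  with \<open>0 \<le> d\<close> have d: "0 < d" by simp
  have "0 < min 2 (e / (2 * d)) \<and> min 2 (e / (2 * d)) \<le> 2"
    using d \<open>0 < e\<close> by simp
  then obtain \<delta> where \<delta>: "0 < \<delta>"
    and uc: "\<And>x y :: 'a. norm x \<le> 1 \<Longrightarrow> norm y \<le> 1 \<Longrightarrow> min 2 (e / (2 * d)) \<le> norm (x - y) \<Longrightarrow>
           norm ((1 / 2) *\<^sub>R (x + y)) \<le> 1 - \<delta>"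
    using assms(1) unfolding uniformly_convex_def by meson
  \<comment> \<open>\<open>\<eta> \<le> d\<close> keeps the scaled distance at least \<open>e / (2 * d)\<close>; \<open>3 * \<eta> \<le> \<delta> * d\<close> makes
      \<open>(1 - \<delta>) * (d + \<eta>) < d - \<eta>\<close>.\<close>
  define \<eta> where "\<eta> = min d (\<delta> * d / 3)"
  have \<eta>: "0 < \<eta>" "\<eta> \<le> d" "3 * \<eta> \<le> \<delta> * d"
    using d \<delta> by (auto simp: \<eta>_def min_def)
  show ?thesis
  proof (rule that[of \<eta>])
    fix x y :: 'a
    assume x: "norm x \<le> d + \<eta>" and y: "norm y \<le> d + \<eta>"
      and m: "d - \<eta> \<le> norm ((1 / 2) *\<^sub>R (x + y))"
    let ?R = "d + \<eta>"
    have R: "0 < ?R" using d \<eta> by simp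
    show "norm (x - y) < e"
    proof (rule ccontr)
      assume "\<not> norm (x - y) < e"
      then have "e / (2 * d) \<le> norm (x - y) / ?R"
        using R d \<eta> \<open>0 < e\<close> by (intro frac_le) auto
      then have "min 2 (e / (2 * d)) \<le> norm ((1 / ?R) *\<^sub>R x - (1 / ?R) *\<^sub>R y)"
        using R by (simp flip: scaleR_diff_right)
      then have "norm ((1 / 2) *\<^sub>R ((1 / ?R) *\<^sub>R x + (1 / ?R) *\<^sub>R y)) \<le> 1 - \<delta>"
        using x y R by (intro uc) auto
      also have "(1 / 2) *\<^sub>R ((1 / ?R) *\<^sub>R x + (1 / ?R) *\<^sub>R y) = (1 / ?R) *\<^sub>R (1 / 2) *\<^sub>R (x + y)"
        by (simp add: scaleR_add_right ac_simps)
      finally have "norm ((1 / 2) *\<^sub>R (x + y)) / ?R \<le> 1 - \<delta>"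
        using R by (simp add: ac_simps)
      then have "norm ((1 / 2) *\<^sub>R (x + y)) \<le> (1 - \<delta>) * ?R"
        using R by (simp only: pos_divide_le_eq)
      also have "\<dots> = d + \<eta> - \<delta> * d - \<delta> * \<eta>" by (simp add: algebra_simps)
      also have "\<dots> < d - \<eta>"
        using \<eta> mult_pos_pos[OF \<delta> \<eta>(1)] by linarith
      finally show False using m by simp
    qed
  qed (use \<eta> in simp)
qed

text \<open>If \<open>t \<le> 1 / 2\<close>, the convex combination lies between \<open>u\<close> and the midpoint, with weight
  \<open>2 * t \<ge> 2 * g\<close> on the latter, so it inherits at least this share of the midpoint's distance to
  the sphere of radius \<open>r\<close>. The case \<open>t \<ge> 1 / 2\<close> is symmetric.\<close>

lemma midpoint_norm_ge:
  fixes u v :: "'a::real_normed_vector"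
  assumes u: "norm u \<le> r" and v: "norm v \<le> r" and g: "0 \<le> g" and t: "g \<le> t" "t \<le> 1 - g"
  shows "2 * g * (r - norm ((1 / 2) *\<^sub>R (u + v))) \<le> r - norm ((1 - t) *\<^sub>R u + t *\<^sub>R v)"
proof -
  let ?m = "(1 / 2) *\<^sub>R (u + v)"
  have m: "norm ?m \<le> r"
    using norm_triangle_ineq[of u v] u v by simp
  \<comment> \<open>The pair \<open>p\<close>, \<open>q\<close> will be \<open>u\<close>, \<open>v\<close> or \<open>v\<close>, \<open>u\<close>, whichever puts the smaller weight on \<open>q\<close>.\<close>
  have key: "2 * g * (r - norm ?m) \<le> r - norm ((1 - s) *\<^sub>R p + s *\<^sub>R q)"
    if "norm p \<le> r" "g \<le> s" "s \<le> 1 / 2" "p + q = u + v" "0 \<le> s" for p q s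
  proof -
    have "(1 - s) *\<^sub>R p + s *\<^sub>R q = (1 - 2 * s) *\<^sub>R p + s *\<^sub>R (p + q)"
      by (simp add: algebra_simps flip: scaleR_add_left)
    also have "\<dots> = (1 - 2 * s) *\<^sub>R p + (2 * s) *\<^sub>R ?m"
      using that by simp
    finally have "norm ((1 - s) *\<^sub>R p + s *\<^sub>R q) \<le> (1 - 2 * s) * norm p + 2 * s * norm ?m"
      using that norm_triangle_ineq[of "(1 - 2 * s) *\<^sub>R p" "(2 * s) *\<^sub>R ?m"] by simp
    also have "\<dots> \<le> (1 - 2 * s) * r + 2 * s * norm ?m"
      using that by (simp add: mult_left_mono)
    finally have "2 * s * (r - norm ?m) \<le> r - norm ((1 - s) *\<^sub>R p + s *\<^sub>R q)"
      by (simp add: algebra_simps)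
    moreover have "2 * g * (r - norm ?m) \<le> 2 * s * (r - norm ?m)"
      using m that by (simp add: mult_right_mono)
    ultimately show ?thesis by linarith
  qed
  show ?thesis
  proof (cases "t \<le> 1 / 2")
    case True
    then show ?thesis using key[of u t v] u t g by simp
  next
    case False
    then show ?thesis using key[of v "1 - t" u] v t g by (simp add: add.commute)
  qed
qed

text \<open>The previous lemma reduces general weights to the midpoint: if the convex combinations stay
  near the sphere of radius \<open>c\<close>, so do the midpoints.\<close>

lemma uniformly_convex_convex_combinations:
  fixes u v :: "nat \<Rightarrow> 'a::real_normed_vector"
  assumes uc: "uniformly_convex TYPE('a)" and g: "0 < g"
    and u: "\<And>n. norm (u n) \<le> r n" and v: "\<And>n. norm (v n) \<le> r n"
    and t: "\<And>n. g \<le> t n" "\<And>n. t n \<le> 1 - g"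
    and r: "r \<longlonglongrightarrow> c"
    and w: "(\<lambda>n. norm ((1 - t n) *\<^sub>R u n + t n *\<^sub>R v n)) \<longlonglongrightarrow> c"
  shows "(\<lambda>n. norm (u n - v n)) \<longlonglongrightarrow> 0"
proof (rule LIMSEQ_I)
  fix e :: real assume e: "0 < e"
  have "0 \<le> r n" for n using u[of n] norm_ge_zero[of "u n"] by linarith
  then have c: "0 \<le> c" using LIMSEQ_le_const[OF r] by blast
  obtain \<eta> where \<eta>: "0 < \<eta>"
    and mid: "\<And>x y :: 'a. norm x \<le> c + \<eta> \<Longrightarrow> norm y \<le> c + \<eta> \<Longrightarrow>
           c - \<eta> \<le> norm ((1 / 2) *\<^sub>R (x + y)) \<Longrightarrow> norm (x - y) < e"
    using uniformly_convex_midpoint[OF uc c e] by blast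
  have "(\<lambda>n. r n - (r n - norm ((1 - t n) *\<^sub>R u n + t n *\<^sub>R v n)) / (2 * g)) \<longlonglongrightarrow> c - (c - c) / (2 * g)"
    using g by (intro tendsto_intros r w) auto
  then have "\<forall>\<^sub>F n in sequentially.
      c - \<eta> < r n - (r n - norm ((1 - t n) *\<^sub>R u n + t n *\<^sub>R v n)) / (2 * g)"
    using \<eta> by (intro order_tendstoD(1)) auto
  moreover have "\<forall>\<^sub>F n in sequentially. r n < c + \<eta>"
    using \<eta> by (intro order_tendstoD(2)[OF r]) auto
  ultimately have "\<forall>\<^sub>F n in sequentially. norm (norm (u n - v n) - 0) < e"
  proof eventually_elim
    case (elim n)
    have "r n - norm ((1 / 2) *\<^sub>R (u n + v n))
        \<le> (r n - norm ((1 - t n) *\<^sub>R u n + t n *\<^sub>R v n)) / (2 * g)"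
      using midpoint_norm_ge[OF u v less_imp_le[OF g] t, of n] g by (simp add: field_simps)
    then have "c - \<eta> \<le> norm ((1 / 2) *\<^sub>R (u n + v n))"
      using elim by linarith
    then have "norm (u n - v n) < e"
      using elim u[of n] v[of n] by (intro mid) linarith+
    then show ?case by simp
  qed
  then show "\<exists>no. \<forall>n\<ge>no. norm (norm (u n - v n) - 0) < e"
    by (simp add: eventually_sequentially)
qed

text \<open>Almost minimal points of the sets form a Cauchy sequence: the midpoint of two of them lies in
  the larger set, hence cannot have a much smaller norm, so uniform convexity forces them to be
  close. The same argument gives uniqueness.\<close>

lemma nested_closed_convex_least_norm:
  fixes S :: "nat \<Rightarrow> 'a::banach set"
  assumes uc: "uniformly_convex TYPE('a)"
    and S: "\<And>n. S n \<noteq> {}" "\<And>n. closed (S n)" "\<And>n. convex (S n)" "decseq S"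
    and lim: "(\<lambda>n. infdist 0 (S n)) \<longlonglongrightarrow> d"
  shows "\<exists>!l. l \<in> (\<Inter>n. S n) \<and> norm l = d"
proof -
  have d: "0 \<le> d"
    by (rule LIMSEQ_le_const[OF lim]) (auto simp: infdist_nonneg)
  have close: "\<exists>N. \<forall>m\<ge>N. \<forall>n\<ge>N. norm (y m - y n) < e"
    if y: "\<And>n. y n \<in> S n" and ylim: "(\<lambda>n. norm (y n)) \<longlonglongrightarrow> d" and e: "0 < e"
    for y :: "nat \<Rightarrow> 'a" and e :: real
  proof -
    obtain \<eta> where \<eta>: "0 < \<eta>"
      and mid: "\<And>x y :: 'a. norm x \<le> d + \<eta> \<Longrightarrow> norm y \<le> d + \<eta> \<Longrightarrow>
             d - \<eta> \<le> norm ((1 / 2) *\<^sub>R (x + y)) \<Longrightarrow> norm (x - y) < e"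
      using uniformly_convex_midpoint[OF uc d e] by blast
    have "\<forall>\<^sub>F n in sequentially. norm (y n) < d + \<eta> \<and> d - \<eta> < infdist 0 (S n)"
      using \<eta> by (intro eventually_conj order_tendstoD(2)[OF ylim] order_tendstoD(1)[OF lim]) auto
    then obtain N where N: "\<And>n. N \<le> n \<Longrightarrow> norm (y n) < d + \<eta> \<and> d - \<eta> < infdist 0 (S n)"
      by (auto simp: eventually_sequentially)
    have "norm (y m - y n) < e" if "N \<le> m" "N \<le> n" for m n
    proof (rule mid)
      have "y m \<in> S N" "y n \<in> S N"
        using y decseqD[OF S(4)] that by blast+
      then have "(1 / 2) *\<^sub>R y m + (1 / 2) *\<^sub>R y n \<in> S N"
        by (intro convexD[OF S(3)]) auto
      then have "infdist 0 (S N) \<le> dist 0 ((1 / 2) *\<^sub>R y m + (1 / 2) *\<^sub>R y n)"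
        by (rule infdist_le)
      then have "infdist 0 (S N) \<le> norm ((1 / 2) *\<^sub>R (y m + y n))"
        by (simp only: dist_0_norm scaleR_add_right)
      then show "d - \<eta> \<le> norm ((1 / 2) *\<^sub>R (y m + y n))"
        using N[of N] by simp
    qed (use N that in \<open>auto intro: less_imp_le\<close>)
    then show ?thesis by blast
  qed
  have "\<exists>y\<in>S n. norm y < infdist 0 (S n) + inverse (real (Suc n))" for n
  proof -
    have "(INF a\<in>S n. dist 0 a) < infdist 0 (S n) + inverse (real (Suc n))"
      using S(1) by (simp add: infdist_notempty)
    then show ?thesis
      using S(1) by (subst (asm) cINF_less_iff) (auto intro: bdd_belowI[of _ 0])
  qed
  then obtain y where y: "\<And>n. y n \<in> S n"
    and y': "\<And>n. norm (y n) < infdist 0 (S n) + inverse (real (Suc n))"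
    by metis
  have ylim: "(\<lambda>n. norm (y n)) \<longlonglongrightarrow> d"
  proof (rule tendsto_sandwich[OF _ _ lim])
    show "(\<lambda>n. infdist 0 (S n) + inverse (real (Suc n))) \<longlonglongrightarrow> d"
      using tendsto_add[OF lim LIMSEQ_inverse_real_of_nat] by simp
    show "\<forall>\<^sub>F n in sequentially. infdist 0 (S n) \<le> norm (y n)"
      using infdist_le[OF y, of 0] by (simp add: dist_norm)
    show "\<forall>\<^sub>F n in sequentially. norm (y n) \<le> infdist 0 (S n) + inverse (real (Suc n))"
      using less_imp_le[OF y'] by (rule always_eventually[OF allI])
  qed
  have "Cauchy y"
    by (rule CauchyI) (rule close[OF y ylim])
  then obtain l where l: "y \<longlonglongrightarrow> l"
    using Cauchy_convergent_iff convergent_def by blast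
  have "norm l = d"
    using LIMSEQ_unique[OF tendsto_norm[OF l] ylim] .
  moreover have "l \<in> S n" for n
  proof (rule Lim_in_closed_set[OF S(2) _ _ l])
    show "\<forall>\<^sub>F k in sequentially. y k \<in> S n"
      using y decseqD[OF S(4)] by (intro eventually_sequentiallyI[of n]) blast
  qed simp
  moreover have "p = q" if "\<And>n. p \<in> S n" "\<And>n. q \<in> S n" "norm p = d" "norm q = d" for p q
  proof (rule ccontr)
    assume "p \<noteq> q"
    define w where "w n = (if even n then p else q)" for n :: nat
    have "w n \<in> S n" "norm (w n) = d" for n
      using that by (simp_all add: w_def)
    then have "\<exists>N. \<forall>m\<ge>N. \<forall>n\<ge>N. norm (w m - w n) < norm (p - q)"
      using \<open>p \<noteq> q\<close> by (intro close) simp_all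
    then obtain N where "\<And>m n. N \<le> m \<Longrightarrow> N \<le> n \<Longrightarrow> norm (w m - w n) < norm (p - q)"
      by blast
    from this[of "2 * N" "2 * N + 1"] show False by (simp add: w_def)
  qed
  ultimately show ?thesis by (intro ex1I[of _ l]) simp_all
qed

section \<open>Weak sequential compactness\<close>

lemma infinite_Int_atLeast: "infinite (B \<inter> {n..})" if "infinite B" for B :: "nat set"
  using that by (auto simp: infinite_nat_iff_unbounded_le) (meson le_trans linorder_linear)

text \<open>Choose a decreasing sequence of infinite sets \<open>f k\<close> such that \<open>D (f k)\<close> is within
  \<open>1 / (k + 1)\<close> of the supremum of \<open>D\<close> over the infinite subsets of \<open>f k\<close>. A diagonal set is, up to
  finitely many elements, a subset of every \<open>f k\<close>; as \<open>D\<close> ignores finite initial segments, the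
  values at its infinite subsets all agree.\<close>

lemma stable_infinite_subset:
  fixes D :: "nat set \<Rightarrow> real"
  assumes anti: "\<And>A B. infinite B \<Longrightarrow> B \<subseteq> A \<Longrightarrow> D A \<le> D B"
    and tail: "\<And>A n. infinite A \<Longrightarrow> D (A \<inter> {n..}) = D A"
    and bdd: "\<And>A. infinite A \<Longrightarrow> D A \<le> M"
  obtains A where "infinite A" and "\<And>B. infinite B \<Longrightarrow> B \<subseteq> A \<Longrightarrow> D B = D A"
proof -
  have step: "\<exists>B. infinite B \<and> B \<subseteq> A \<and> (\<forall>C. infinite C \<longrightarrow> C \<subseteq> B \<longrightarrow> D C \<le> D B + e)"
    if A: "infinite A" and e: "0 < e" for A and e :: real
  proof -
    let ?V = "D ` {B. infinite B \<and> B \<subseteq> A}"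
    have V: "?V \<noteq> {}" "bdd_above ?V"
      using A bdd by (auto intro!: bdd_aboveI[of _ M])
    have "Sup ?V - e < Sup ?V" using e by simp
    then obtain B where B: "infinite B" "B \<subseteq> A" "Sup ?V - e < D B"
      using less_cSup_iff[OF V] by auto
    have "D C \<le> D B + e" if "infinite C" "C \<subseteq> B" for C
    proof -
      have "D C \<le> Sup ?V" using that B by (intro cSup_upper V) auto
      then show ?thesis using B by simp
    qed
    with B show ?thesis by blast
  qed
  let ?P = "\<lambda>k A. infinite A \<and>
    (\<forall>C. infinite C \<longrightarrow> C \<subseteq> A \<longrightarrow> D C \<le> D A + inverse (real (Suc k)))"
  have "\<exists>f. \<forall>k. ?P k (f k) \<and> f (Suc k) \<subseteq> f k"
  proof (rule dependent_nat_choice[where P = ?P and Q = "\<lambda>_ A B. B \<subseteq> A"])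
    show "\<exists>A. ?P 0 A" using step[of UNIV "inverse (real (Suc 0))"] by auto
    show "\<exists>B. ?P (Suc k) B \<and> B \<subseteq> A" if "?P k A" for A k
      using step[of A "inverse (real (Suc (Suc k)))"] that
      by (metis inverse_positive_iff_positive of_nat_0_less_iff zero_less_Suc)
  qed
  then obtain f where f: "\<And>k. infinite (f k)" "\<And>k. f (Suc k) \<subseteq> f k"
    and fD: "\<And>k C. infinite C \<Longrightarrow> C \<subseteq> f k \<Longrightarrow> D C \<le> D (f k) + inverse (real (Suc k))"
    by metis
  have dec: "f n \<subseteq> f k" if "k \<le> n" for k n
    using lift_Suc_antimono_le[of f] f(2) that by blast
  have "\<exists>r. \<forall>k. r k \<in> f k \<and> r k < r (Suc k)"
  proof (rule dependent_nat_choice)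
    show "\<exists>x. x \<in> f 0" using f(1)[of 0] by (metis finite.emptyI equals0I)
    show "\<exists>y. y \<in> f (Suc n) \<and> x < y" for x n
      using f(1)[of "Suc n"] by (auto simp: infinite_nat_iff_unbounded)
  qed
  then obtain r where r: "\<And>k. r k \<in> f k" "strict_mono r"
    by (auto simp: strict_mono_Suc_iff)
  have A: "infinite (range r)"
    using r(2) strict_mono_imp_inj_on range_inj_infinite by blast
  have sub: "range r \<inter> {r k..} \<subseteq> f k" for k
    using r dec strict_mono_less_eq[OF r(2)] by fastforce
  have le: "D B \<le> D (range r) + inverse (real (Suc k))" if B: "infinite B" "B \<subseteq> range r" for B k
  proof -
    have "D B = D (B \<inter> {r k..})" using tail B by simp
    also have "\<dots> \<le> D (f k) + inverse (real (Suc k))"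
      using sub[of k] B by (intro fD infinite_Int_atLeast) auto
    also have "D (f k) \<le> D (range r \<inter> {r k..})"
      using sub by (intro anti infinite_Int_atLeast A)
    also have "\<dots> = D (range r)" using tail A by simp
    finally show ?thesis by simp
  qed
  have "D B = D (range r)" if B: "infinite B" "B \<subseteq> range r" for B
  proof (rule antisym)
    have "(\<lambda>k. D (range r) + inverse (real (Suc k))) \<longlonglongrightarrow> D (range r)"
      using tendsto_add[OF tendsto_const LIMSEQ_inverse_real_of_nat] by simp
    then show "D B \<le> D (range r)"
      by (rule LIMSEQ_le_const) (use le[OF B] in blast)
    show "D (range r) \<le> D B" using anti B by simp
  qed
  with A show ?thesis by (rule that)
qed

definition tail_hull :: "(nat \<Rightarrow> 'a::real_normed_vector) \<Rightarrow> nat set \<Rightarrow> nat \<Rightarrow> 'a set" where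
  "tail_hull u A n = closure (convex hull (u ` (A \<inter> {n..})))"

lemma tail_hull_mono: "B \<subseteq> A \<Longrightarrow> m \<le> n \<Longrightarrow> tail_hull u B n \<subseteq> tail_hull u A m"
  unfolding tail_hull_def by (intro closure_mono hull_mono image_mono) auto

lemma tail_hull_nonempty:
  assumes "infinite A" shows "tail_hull u A n \<noteq> {}"
proof -
  have "A \<inter> {n..} \<noteq> {}"
    using assms by (auto simp: infinite_nat_iff_unbounded_le)
  then show ?thesis by (simp add: tail_hull_def)
qed

text \<open>The number \<open>D A\<close> measures how far the closed convex hulls of the tails along \<open>A\<close> eventually
  stay from the origin, and \<open>stable_infinite_subset\<close> makes it the same for all infinite subsets of a
  suitable \<open>A\<close>. The point of norm \<open>D B\<close> common to the hulls of \<open>B \<subseteq> A\<close> then is a point of norm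
  \<open>D A\<close> common to the larger hulls of \<open>A\<close>, and there is only one such point.\<close>

lemma common_tail_hull_point:
  fixes u :: "nat \<Rightarrow> 'a::banach"
  assumes uc: "uniformly_convex TYPE('a)" and bdd: "bounded (range u)"
  obtains A l where "infinite A"
    and "\<And>B. infinite B \<Longrightarrow> B \<subseteq> A \<Longrightarrow> l \<in> tail_hull u B 0"
proof -
  let ?S = "tail_hull u"
  obtain M where M: "\<And>n. norm (u n) \<le> M"
    using bdd by (auto simp: bounded_iff)
  define D where "D A = (SUP n. infdist 0 (?S A n))" for A
  have le_M: "infdist 0 (?S A n) \<le> M" if A: "infinite A" for A n
  proof -
    obtain k where "k \<in> A \<inter> {n..}"
      using A by (auto simp: infinite_nat_iff_unbounded_le)
    then have "u k \<in> ?S A n"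
      unfolding tail_hull_def by (intro subsetD[OF closure_subset] hull_inc imageI)
    from infdist_le[OF this, of 0] M[of k] show ?thesis by (simp add: dist_norm)
  qed
  have mono: "infdist 0 (?S A m) \<le> infdist 0 (?S B n)" if "infinite B" "B \<subseteq> A" "m \<le> n" for A B m n
    using that by (intro infdist_mono tail_hull_mono tail_hull_nonempty)
  have bddS: "bdd_above (range (\<lambda>n. infdist 0 (?S A n)))" if "infinite A" for A
    using le_M[OF that] by (auto intro!: bdd_aboveI[of _ M])
  have lim: "(\<lambda>n. infdist 0 (?S A n)) \<longlonglongrightarrow> D A" if "infinite A" for A
    unfolding D_def using that mono[OF that subset_refl]
    by (intro LIMSEQ_incseq_SUP bddS) (auto simp: incseq_def)
  have anti: "D A \<le> D B" if "infinite B" "B \<subseteq> A" for A B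
    using that mono[OF that] lim[of A] lim[of B] infinite_super[of B A]
    by (intro LIMSEQ_le[OF lim lim]) auto
  have tail: "D (A \<inter> {n..}) = D A" if A: "infinite A" for A n
  proof (rule antisym)
    have "infdist 0 (?S (A \<inter> {n..}) m) \<le> D A" for m
    proof -
      have "A \<inter> {n..} \<inter> {m..} = A \<inter> {max n m..}" by auto
      then have "infdist 0 (?S (A \<inter> {n..}) m) = infdist 0 (?S A (max n m))"
        by (simp add: tail_hull_def)
      also have "\<dots> \<le> D A"
        unfolding D_def by (intro cSUP_upper bddS A) simp
      finally show ?thesis .
    qed
    then show "D (A \<inter> {n..}) \<le> D A"
      unfolding D_def[of "A \<inter> {n..}"] by (intro cSUP_least) auto
    show "D A \<le> D (A \<inter> {n..})"
      by (intro anti infinite_Int_atLeast A) simp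
  qed
  have D_le: "D A \<le> M" if "infinite A" for A
    unfolding D_def using le_M[OF that] by (intro cSUP_least) auto
  obtain A where A: "infinite A" and stable: "\<And>B. infinite B \<Longrightarrow> B \<subseteq> A \<Longrightarrow> D B = D A"
    using stable_infinite_subset[of D, OF anti tail D_le] by blast
  have ex1: "\<exists>!l. l \<in> (\<Inter>n. ?S B n) \<and> norm l = D B" if "infinite B" for B
    using that
    by (intro nested_closed_convex_least_norm[OF uc] lim tail_hull_nonempty)
       (auto simp: tail_hull_def decseq_def convex_closure intro!: closure_mono hull_mono)
  obtain l where l: "l \<in> (\<Inter>n. ?S A n)" "norm l = D A"
    using ex1[OF A] by blast
  have "l \<in> ?S B 0" if B: "infinite B" "B \<subseteq> A" for B
  proof -
    obtain l' where l': "l' \<in> (\<Inter>n. ?S B n)" "norm l' = D B"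
      using ex1[OF B(1)] by blast
    then have "l' \<in> (\<Inter>n. ?S A n)" "norm l' = D A"
      using tail_hull_mono[OF B(2) order_refl, of u] stable[OF B] by auto
    then have "l' = l" using l ex1[OF A] by blast
    with l' show ?thesis by blast
  qed
  with A show ?thesis by (rule that)
qed

text \<open>If \<open>f (u k) \<ge> f l + e\<close> held for all \<open>k\<close> in an infinite \<open>B \<subseteq> A\<close>, the closed half-space
  \<open>{y. f l + e \<le> f y}\<close> would contain the closed convex hull of \<open>u ` B\<close>, hence \<open>l\<close>. Applying this
  to \<open>f\<close> and to \<open>- f\<close> gives convergence along \<open>A\<close>. The last conclusion places the weak limit in any
  closed convex set that contains the sequence.\<close>

theorem uniformly_convex_weakly_convergent_subsequence:
  fixes u :: "nat \<Rightarrow> 'a::banach"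
  assumes uc: "uniformly_convex TYPE('a)" and bdd: "bounded (range u)"
  obtains r l where "strict_mono (r :: nat \<Rightarrow> nat)" and "weakly_convergent_to (u \<circ> r) l"
    and "l \<in> closure (convex hull (range u))"
proof -
  obtain A l where A: "infinite A"
    and l: "\<And>B. infinite B \<Longrightarrow> B \<subseteq> A \<Longrightarrow> l \<in> tail_hull u B 0"
    using common_tail_hull_point[OF uc bdd] by blast
  have one_sided: "finite {k \<in> A. f l + e \<le> f (u k)}" if f: "bounded_linear f" and e: "0 < e"
    for f :: "'a \<Rightarrow> real" and e :: real
  proof (rule ccontr)
    let ?B = "{k \<in> A. f l + e \<le> f (u k)}" and ?H = "{y. f l + e \<le> f y}"
    assume "infinite ?B"
    then have "l \<in> tail_hull u ?B 0" by (intro l) auto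
    also have "\<dots> \<subseteq> ?H"
    proof -
      interpret f: bounded_linear f by (rule f)
      have "closed ?H"
        by (intro closed_Collect_le continuous_intros linear_continuous_on f)
      moreover have "convex ?H"
        using convex_linear_vimage[OF f.linear_axioms, of "{f l + e..}"] by (simp add: vimage_def)
      ultimately show ?thesis
        unfolding tail_hull_def by (intro closure_minimal hull_minimal) auto
    qed
    finally show False using e by simp
  qed
  define r where "r = enumerate A"
  have r: "strict_mono r" and rA: "\<And>n. r n \<in> A"
    using A by (auto simp: r_def strict_mono_enumerate enumerate_in_set)
  have "weakly_convergent_to (u \<circ> r) l"
    unfolding weakly_convergent_to_def
  proof (intro allI impI)
    fix f :: "'a \<Rightarrow> real" assume f: "bounded_linear f"
    have ev: "\<forall>\<^sub>F n in sequentially. h (u (r n)) < h l + e" if "bounded_linear h" "0 < e"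
      for h :: "'a \<Rightarrow> real" and e
    proof -
      have "finite {n. \<not> h (u (r n)) < h l + e}"
      proof (rule finite_imageD)
        show "finite (r ` {n. \<not> h (u (r n)) < h l + e})"
          using rA by (intro finite_subset[OF _ one_sided[OF that]]) auto
        show "inj_on r {n. \<not> h (u (r n)) < h l + e}"
          using strict_mono_imp_inj_on[OF r] inj_on_subset by blast
      qed
      then show ?thesis
        by (simp add: eventually_cofinite flip: cofinite_eq_sequentially)
    qed
    show "(\<lambda>n. f ((u \<circ> r) n)) \<longlonglongrightarrow> f l"
    proof (rule tendstoI)
      fix e :: real assume e: "0 < e"
      show "\<forall>\<^sub>F n in sequentially. dist (f ((u \<circ> r) n)) (f l) < e"
        using ev[OF f e] ev[OF bounded_linear_minus[OF f] e]
        by eventually_elim (auto simp: dist_real_def)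
    qed
  qed
  moreover have "l \<in> closure (convex hull (range u))"
    using l[OF A subset_refl] closure_mono[OF hull_mono[of "u ` A" "range u"]]
    by (auto simp: tail_hull_def)
  ultimately show ?thesis by (rule that[OF r])
qed

section \<open>Mappings satisfying condition (C)\<close>

lemma condition_C_quasi_nonexpansive:
  assumes "condition_C C T" and "p \<in> fixed_points C T" and "x \<in> C"
  shows "norm (T x - p) \<le> norm (x - p)"
proof -
  have p: "p \<in> C" "T p = p" using assms(2) by (auto simp: fixed_points_def)
  then have "1 / 2 * norm (p - T p) \<le> norm (p - x)" by simp
  then have "norm (T p - T x) \<le> norm (p - x)"
    using assms(1,3) p(1) unfolding condition_C_def by blast
  then show ?thesis using p(2) by (simp add: norm_minus_commute)
qed

text \<open>At least one of the pairs \<open>x\<close>, \<open>y\<close> and \<open>T x\<close>, \<open>y\<close> satisfies the premise of condition (C):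
  otherwise \<open>norm (x - T x) \<le> norm (x - y) + norm (T x - y)\<close> would be less than half of
  \<open>norm (x - T x) + norm (T x - T (T x))\<close>, which is at most \<open>norm (x - T x)\<close>. The
  second pair is the costly one: the path from \<open>x\<close> over \<open>T x\<close> and \<open>T (T x)\<close> to \<open>T y\<close>, together
  with the step from \<open>T x\<close> back to \<open>x\<close> and on to \<open>y\<close>, accounts for the factor \<open>3\<close>.\<close>

lemma condition_C_displacement:
  assumes T: "T \<in> C \<rightarrow> C" and cond: "condition_C C T" and x: "x \<in> C" and y: "y \<in> C"
  shows "norm (x - T y) \<le> 3 * norm (x - T x) + norm (x - y)"
proof -
  have nonexp: "norm (T p - T q) \<le> norm (p - q)"
    if "p \<in> C" "q \<in> C" "1 / 2 * norm (p - T p) \<le> norm (p - q)" for p q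
    using cond that unfolding condition_C_def by blast
  have Tx: "T x \<in> C" using T x by blast
  have TT: "norm (T x - T (T x)) \<le> norm (x - T x)"
    using x Tx by (intro nonexp) auto
  show ?thesis
  proof (cases "1 / 2 * norm (x - T x) \<le> norm (x - y)")
    case True
    have "norm (x - T y) \<le> norm (x - T x) + norm (T x - T y)"
      using norm_triangle_ineq[of "x - T x" "T x - T y"] by simp
    then show ?thesis using nonexp[OF x y True] norm_ge_zero[of "x - T x"] by linarith
  next
    case False
    have "norm (x - T x) \<le> norm (x - y) + norm (T x - y)"
      using norm_triangle_ineq4[of "x - y" "T x - y"] by simp
    then have "1 / 2 * norm (T x - T (T x)) \<le> norm (T x - y)"
      using False TT by linarith
    then have "norm (T (T x) - T y) \<le> norm (T x - y)"
      by (intro nonexp Tx y)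
    moreover have "norm (T x - y) \<le> norm (x - T x) + norm (x - y)"
      using norm_triangle_ineq4[of "x - y" "x - T x"] by simp
    moreover have "norm (x - T y) \<le> norm (x - T x) + norm (T x - T (T x)) + norm (T (T x) - T y)"
      using norm_triangle_ineq[of "x - T x" "T x - T (T x)"]
        norm_triangle_ineq[of "x - T (T x)" "T (T x) - T y"] by simp
    ultimately show ?thesis using TT by linarith
  qed
qed

text \<open>By \<open>condition_C_displacement\<close>, \<open>T l\<close> is asymptotically no farther from \<open>u\<close> than \<open>l\<close>; by
  Opial's property only the weak limit itself can be that close.\<close>

lemma condition_C_demiclosed:
  fixes u :: "nat \<Rightarrow> 'a::real_normed_vector"
  assumes opial: "opial_property TYPE('a)" and T: "T \<in> C \<rightarrow> C" and cond: "condition_C C T"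
    and u: "\<And>n. u n \<in> C" and l: "l \<in> C" and weak: "weakly_convergent_to u l"
    and reg: "(\<lambda>n. norm (u n - T (u n))) \<longlonglongrightarrow> 0"
  shows "l \<in> fixed_points C T"
proof (rule ccontr)
  assume "l \<notin> fixed_points C T"
  then have "T l \<noteq> l" using l by (simp add: fixed_points_def)
  then have "limsup (\<lambda>n. ereal (norm (u n - l))) < limsup (\<lambda>n. ereal (norm (u n - T l)))"
    using opial weak unfolding opial_property_def by blast
  also have "\<dots> \<le> limsup (\<lambda>n. ereal (3 * norm (u n - T (u n))) + ereal (norm (u n - l)))"
    using condition_C_displacement[OF T cond u l] by (intro Limsup_mono) simp
  also have "\<dots> = 0 + limsup (\<lambda>n. ereal (norm (u n - l)))"
  proof (rule ereal_limsup_lim_add)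
    show "(\<lambda>n. ereal (3 * norm (u n - T (u n)))) \<longlonglongrightarrow> 0"
      using tendsto_mult[OF tendsto_const[of 3] reg] by (simp add: zero_ereal_def)
  qed simp
  finally show False by simp
qed

text \<open>The limits of \<open>norm (x n - p)\<close> and \<open>norm (x n - q)\<close> are the same along all subsequences, so
  Opial's property along \<open>r\<close> and along \<open>s\<close> compares the same two numbers, in opposite directions.\<close>

lemma opial_weak_limits_eq:
  fixes x :: "nat \<Rightarrow> 'a::real_normed_vector"
  assumes opial: "opial_property TYPE('a)"
    and r: "strict_mono r" "weakly_convergent_to (x \<circ> r) p"
    and s: "strict_mono s" "weakly_convergent_to (x \<circ> s) q"
    and p: "convergent (\<lambda>n. norm (x n - p))" and q: "convergent (\<lambda>n. norm (x n - q))"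
  shows "p = q"
proof (rule ccontr)
  assume "p \<noteq> q"
  obtain P Q where P: "(\<lambda>n. norm (x n - p)) \<longlonglongrightarrow> P" and Q: "(\<lambda>n. norm (x n - q)) \<longlonglongrightarrow> Q"
    using p q unfolding convergent_def by blast
  have sub: "limsup (\<lambda>n. ereal (norm ((x \<circ> t) n - w))) = ereal L"
    if "(\<lambda>n. norm (x n - w)) \<longlonglongrightarrow> L" "strict_mono t" for t w L
    using LIMSEQ_subseq_LIMSEQ[OF that]
    by (intro lim_imp_Limsup) (auto simp: o_def)
  have "ereal P < ereal Q"
    using opial r(2) \<open>p \<noteq> q\<close> sub[OF P r(1)] sub[OF Q r(1)] unfolding opial_property_def by metis
  moreover have "ereal Q < ereal P"
    using opial s(2) \<open>p \<noteq> q\<close> sub[OF P s(1)] sub[OF Q s(1)] unfolding opial_property_def by metis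
  ultimately show False by simp
qed

lemma weakly_convergent_to_if_subsequences:
  assumes "\<And>s :: nat \<Rightarrow> nat. strict_mono s \<Longrightarrow> \<exists>r. strict_mono r \<and> weakly_convergent_to (x \<circ> s \<circ> r) p"
  shows "weakly_convergent_to x p"
  unfolding weakly_convergent_to_def
proof (intro allI impI)
  fix f :: "'a \<Rightarrow> real" assume f: "bounded_linear f"
  show "(\<lambda>n. f (x n)) \<longlonglongrightarrow> f p"
  proof (rule tendstoI, rule ccontr)
    fix e :: real assume e: "0 < e" and
      "\<not> (\<forall>\<^sub>F n in sequentially. dist (f (x n)) (f p) < e)"
    then have inf: "infinite {n. \<not> dist (f (x n)) (f p) < e}"
      by (simp add: eventually_cofinite flip: cofinite_eq_sequentially)
    define s where "s = enumerate {n. \<not> dist (f (x n)) (f p) < e}"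
    have s: "strict_mono s" and far: "\<not> dist (f (x (s n))) (f p) < e" for n
      using inf enumerate_in_set[OF inf, of n] by (auto simp: s_def strict_mono_enumerate)
    obtain r where "weakly_convergent_to (x \<circ> s \<circ> r) p"
      using assms[OF s] by blast
    then have "(\<lambda>n. f ((x \<circ> s \<circ> r) n)) \<longlonglongrightarrow> f p"
      using f unfolding weakly_convergent_to_def by blast
    then have "\<forall>\<^sub>F n in sequentially. dist (f ((x \<circ> s \<circ> r) n)) (f p) < e"
      using e by (rule tendstoD)
    then have "\<forall>\<^sub>F n in sequentially. False"
      by eventually_elim (use far in simp)
    then show False by simp
  qed
qed

theorem weak_convergence_of_approximate_fixed_points:
  fixes x :: "nat \<Rightarrow> 'a::banach"
  assumes uc: "uniformly_convex TYPE('a)" and opial: "opial_property TYPE('a)"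
    and C: "closed C" "convex C" and T: "T \<in> C \<rightarrow> C" and cond: "condition_C C T"
    and x: "\<And>n. x n \<in> C" and bdd: "bounded (range x)"
    and reg: "(\<lambda>n. norm (x n - T (x n))) \<longlonglongrightarrow> 0"
    and conv: "\<And>p. p \<in> fixed_points C T \<Longrightarrow> convergent (\<lambda>n. norm (x n - p))"
  shows "\<exists>p\<in>fixed_points C T. weakly_convergent_to x p"
proof -
  have sub: "\<exists>r l. strict_mono r \<and> weakly_convergent_to (x \<circ> s \<circ> r) l \<and> l \<in> fixed_points C T"
    if s: "strict_mono s" for s :: "nat \<Rightarrow> nat"
  proof -
    have "bounded (range (x \<circ> s))"
      by (rule bounded_subset[OF bdd]) auto
    from uniformly_convex_weakly_convergent_subsequence[OF uc this]
    obtain r l where r: "strict_mono r" and weak: "weakly_convergent_to (x \<circ> s \<circ> r) l"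
      and l: "l \<in> closure (convex hull (range (x \<circ> s)))" by blast
    have "closure (convex hull (range (x \<circ> s))) \<subseteq> C"
      using x C by (intro closure_minimal hull_minimal) auto
    then have "l \<in> C" using l by blast
    moreover have "(\<lambda>n. norm ((x \<circ> s \<circ> r) n - T ((x \<circ> s \<circ> r) n))) \<longlonglongrightarrow> 0"
      using LIMSEQ_subseq_LIMSEQ[OF reg strict_mono_o[OF s r]] by (simp add: o_def)
    ultimately have "l \<in> fixed_points C T"
      using x weak by (intro condition_C_demiclosed[OF opial T cond, of "x \<circ> s \<circ> r"]) auto
    with r weak show ?thesis by blast
  qed
  from sub[of id] obtain r p where r: "strict_mono r" "weakly_convergent_to (x \<circ> r) p"
    and p: "p \<in> fixed_points C T" by (auto simp: strict_mono_id)
  have "weakly_convergent_to x p"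
  proof (rule weakly_convergent_to_if_subsequences)
    fix s :: "nat \<Rightarrow> nat" assume s: "strict_mono s"
    then obtain t l where t: "strict_mono t" "weakly_convergent_to (x \<circ> s \<circ> t) l"
      and l: "l \<in> fixed_points C T" using sub by blast
    have "weakly_convergent_to (x \<circ> (s \<circ> t)) l"
      using t by (simp add: o_assoc)
    then have "p = l"
      using opial_weak_limits_eq[OF opial r strict_mono_o[OF s t(1)]] conv[OF p] conv[OF l] by blast
    with t show "\<exists>r. strict_mono r \<and> weakly_convergent_to (x \<circ> s \<circ> r) p" by blast
  qed
  with p show ?thesis by blast
qed

section \<open>The iteration\<close>

theorem theorem4p3:
  fixes C :: "'a::banach set"
    and T :: "'a \<Rightarrow> 'a"
    and x y z :: "nat \<Rightarrow> 'a"
    and \<alpha> \<beta> :: "nat \<Rightarrow> real"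
    and a b :: real
  assumes "uniformly_convex TYPE('a)"
    and "opial_property TYPE('a)"
    and "C \<noteq> {}" and "closed C" and "convex C"
    and "T \<in> C \<rightarrow> C"
    and "condition_C C T"
    and "fixed_points C T \<noteq> {}"
    and "0 < a" and "a \<le> b" and "b < 1"
    and "\<And>n. \<alpha> n \<in> {a..b}"
    and "\<And>n. \<beta> n \<in> {a..b}"
    and "x 0 \<in> C"
    and "\<And>n. z n = (1 - \<beta> n) *\<^sub>R x n + \<beta> n *\<^sub>R T (x n)"
    and "\<And>n. y n = T ((1 - \<alpha> n) *\<^sub>R T (x n) + \<alpha> n *\<^sub>R T (z n))"
    and "\<And>n. x (Suc n) = T (y n)"
  shows "\<exists>p\<in>fixed_points C T. weakly_convergent_to x p"
proof -
  note uc = assms(1) and opial = assms(2) and T = assms(6) and cond = assms(7)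
    and z = assms(15) and y = assms(16) and xSuc = assms(17)
  have TC: "T w \<in> C" if "w \<in> C" for w using T that by blast
  have \<alpha>: "0 < \<alpha> n" "\<alpha> n < 1" "a \<le> \<alpha> n" and \<beta>: "0 < \<beta> n" "\<beta> n < 1" "a \<le> \<beta> n" "\<beta> n \<le> b" for n
    using assms(9-11) assms(12,13)[of n] by auto
  have comb: "(1 - t) *\<^sub>R v + t *\<^sub>R w \<in> C" if "v \<in> C" "w \<in> C" "0 < t" "t < 1" for v w t
    using convexD[OF assms(5), of v w "1 - t" t] that by simp
  have zC: "z n \<in> C" and yC: "y n \<in> C"
    and inC: "(1 - \<alpha> n) *\<^sub>R T (x n) + \<alpha> n *\<^sub>R T (z n) \<in> C" if "x n \<in> C" for n
  proof -
    show *: "z n \<in> C" unfolding z using that \<beta> by (intro comb TC)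
    show **: "(1 - \<alpha> n) *\<^sub>R T (x n) + \<alpha> n *\<^sub>R T (z n) \<in> C" using that * \<alpha> by (intro comb TC)
    show "y n \<in> C" unfolding y using ** by (rule TC)
  qed
  have xC: "x n \<in> C" for n
    by (induction n) (use assms(14) xSuc TC yC in auto)
  have comb_norm: "norm ((1 - t) *\<^sub>R v + t *\<^sub>R w - p) \<le> (1 - t) * norm (v - p) + t * norm (w - p)"
    if "0 < t" "t < 1" for v w p :: 'a and t
  proof -
    have "(1 - t) *\<^sub>R v + t *\<^sub>R w - p = (1 - t) *\<^sub>R (v - p) + t *\<^sub>R (w - p)"
      by (simp add: algebra_simps)
    then show ?thesis
      using that norm_triangle_ineq[of "(1 - t) *\<^sub>R (v - p)" "t *\<^sub>R (w - p)"] by simp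
  qed
  have quasi: "norm (T w - p) \<le> norm (w - p)" if "p \<in> fixed_points C T" "w \<in> C" for w p
    using condition_C_quasi_nonexpansive[OF cond that] .
  have z_le: "norm (z n - p) \<le> norm (x n - p)" if p: "p \<in> fixed_points C T" for n p
  proof -
    have "norm (z n - p) \<le> (1 - \<beta> n) * norm (x n - p) + \<beta> n * norm (T (x n) - p)"
      unfolding z by (rule comb_norm) (rule \<beta>)+
    also have "\<dots> \<le> (1 - \<beta> n) * norm (x n - p) + \<beta> n * norm (x n - p)"
      using \<beta>[of n] quasi[OF p xC] by (intro add_left_mono mult_left_mono) auto
    finally show ?thesis by (simp add: algebra_simps)
  qed
  have x_le: "norm (x (Suc n) - p) \<le> norm (x n - p) - a * (norm (x n - p) - norm (z n - p))"
    if p: "p \<in> fixed_points C T" for n p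
  proof -
    have "norm (x (Suc n) - p) \<le> norm (y n - p)"
      unfolding xSuc by (rule quasi[OF p yC[OF xC]])
    also have "\<dots> \<le> norm ((1 - \<alpha> n) *\<^sub>R T (x n) + \<alpha> n *\<^sub>R T (z n) - p)"
      unfolding y by (rule quasi[OF p inC[OF xC]])
    also have "\<dots> \<le> (1 - \<alpha> n) * norm (T (x n) - p) + \<alpha> n * norm (T (z n) - p)"
      by (rule comb_norm) (rule \<alpha>)+
    also have "\<dots> \<le> (1 - \<alpha> n) * norm (x n - p) + \<alpha> n * norm (z n - p)"
      using \<alpha>[of n] quasi[OF p xC] quasi[OF p zC[OF xC]]
      by (intro add_mono mult_left_mono) auto
    also have "\<dots> = norm (x n - p) - \<alpha> n * (norm (x n - p) - norm (z n - p))"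
      by (simp add: algebra_simps)
    also have "\<dots> \<le> norm (x n - p) - a * (norm (x n - p) - norm (z n - p))"
      using \<alpha>[of n] z_le[OF p, of n] by (simp add: mult_right_mono)
    finally show ?thesis .
  qed
  have dec: "decseq (\<lambda>n. norm (x n - p))" if p: "p \<in> fixed_points C T" for p
  proof (rule decseq_SucI)
    fix n
    have "0 \<le> a * (norm (x n - p) - norm (z n - p))"
      using z_le[OF p, of n] assms(9) by simp
    then show "norm (x (Suc n) - p) \<le> norm (x n - p)" using x_le[OF p, of n] by linarith
  qed
  have conv: "convergent (\<lambda>n. norm (x n - p))" if p: "p \<in> fixed_points C T" for p
    using decseq_convergent[OF dec[OF p], of 0] by (auto simp: convergent_def)
  obtain p where p: "p \<in> fixed_points C T" using assms(8) by blast
  obtain c where c: "(\<lambda>n. norm (x n - p)) \<longlonglongrightarrow> c"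
    using conv[OF p] by (auto simp: convergent_def)
  have bdd: "bounded (range x)"
  proof (rule boundedI)
    fix w assume "w \<in> range x"
    then obtain n where "w = x n" by blast
    then show "norm w \<le> norm (x 0 - p) + norm p"
      using decseqD[OF dec[OF p], of 0 n] norm_triangle_ineq[of "x n - p" p] by simp
  qed
  have "(\<lambda>n. norm (z n - p)) \<longlonglongrightarrow> c"
  proof (rule tendsto_sandwich[OF _ _ _ c])
    show "\<forall>\<^sub>F n in sequentially.
        norm (x n - p) - (norm (x n - p) - norm (x (Suc n) - p)) / a \<le> norm (z n - p)"
      using x_le[OF p] assms(9) by (simp add: field_simps)
    show "\<forall>\<^sub>F n in sequentially. norm (z n - p) \<le> norm (x n - p)"
      using z_le[OF p] by simp
    have "(\<lambda>n. norm (x n - p) - (norm (x n - p) - norm (x (Suc n) - p)) / a) \<longlonglongrightarrow> c - (c - c) / a"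
      using assms(9) by (intro tendsto_intros c LIMSEQ_Suc[OF c]) auto
    then show "(\<lambda>n. norm (x n - p) - (norm (x n - p) - norm (x (Suc n) - p)) / a) \<longlonglongrightarrow> c"
      by simp
  qed
  moreover have "z n - p = (1 - \<beta> n) *\<^sub>R (x n - p) + \<beta> n *\<^sub>R (T (x n) - p)" for n
    by (simp add: z algebra_simps)
  ultimately have "(\<lambda>n. norm ((1 - \<beta> n) *\<^sub>R (x n - p) + \<beta> n *\<^sub>R (T (x n) - p))) \<longlonglongrightarrow> c"
    by simp
  moreover have "0 < min a (1 - b)" using assms(9,11) by simp
  moreover have "min a (1 - b) \<le> \<beta> n" "\<beta> n \<le> 1 - min a (1 - b)" for n
    using \<beta>[of n] by linarith+
  ultimately have "(\<lambda>n. norm ((x n - p) - (T (x n) - p))) \<longlonglongrightarrow> 0"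
    by (intro uniformly_convex_convex_combinations[OF uc _ order_refl quasi[OF p xC] _ _ c])
  then have "(\<lambda>n. norm (x n - T (x n))) \<longlonglongrightarrow> 0" by simp
  then show ?thesis
    using weak_convergence_of_approximate_fixed_points[OF uc opial assms(4,5) T cond xC bdd _ conv]
    by blast
qed

end
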